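(* Let $(X,\mu)$ be a Samuel realcompact space and $(Y,\nu)$ any uniform space. Then $$H(U_{\mu\times\nu}(X\times Y))=H(U_\mu(X))\times H(U_\nu(Y))=X\times H(U_\nu(Y)).$$
   Context: Uniform spaces are Hausdorff. $\mu\times\nu$ is the product uniformity on $X\times Y$. For a uniform space $(Z,\lambda)$, $U_\lambda(Z)$ is the set of real-valued uniformly continuous functions on $(Z,\lambda)$ and $wU_\lambda(Z)$ is the weakest uniformity on $Z$ making all $f\in U_\lambda(Z)$ uniformly continuous. A space is realcompact if it is homeomorphic to a closed subspace of a product of real lines; a realcompactification of $Z$ is a realcompact space in which $Z$ is densely embedded. $H(U_\lambda(Z))$ is the Samuel realcompactification of $(Z,\lambda)$: the smallest realcompactification of $Z$ to which every $f\in U_\lambda(Z)$ extends continuously; topologically it is the completion of $(Z,wU_\lambda(Z))$. $(Z,\lambda)$ is Samuel realcompact if $Z=H(U_\lambda(Z))$, equivalently if $(Z,wU_\lambda(Z))$ is complete. Equality of realcompactifications means equivalence: there is a homeomorphism between them leaving the base space (here $X\times Y$) pointwise fixed. *)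

theory Defs
  imports "HOL-Analysis.Analysis"
begin

section \<open>Realcompactifications\<close>

text \<open>
  The index set ranges over subsets of the type of real functions on the points. Any other index
  type gives the same notion: see \<open>realcompact_spaceI\<close>.
\<close>
definition realcompact_space :: "'a topology \<Rightarrow> bool"
  where "realcompact_space T \<longleftrightarrow>
    (\<exists>(I :: ('a \<Rightarrow> real) set) C. closedin (powertop_real I) C \<and>
       T homeomorphic_space subtopology (powertop_real I) C)"

definition realcompactification :: "'a topology \<Rightarrow> 'b topology \<Rightarrow> ('a \<Rightarrow> 'b) \<Rightarrow> bool"
  where "realcompactification Z H e \<longleftrightarrow>
    realcompact_space H \<and> embedding_map Z H e \<and> H closure_of (e ` topspace Z) = topspace H"

definition realcompactification_le ::
    "'a topology \<Rightarrow> 'b topology \<Rightarrow> ('a \<Rightarrow> 'b) \<Rightarrow> 'c topology \<Rightarrow> ('a \<Rightarrow> 'c) \<Rightarrow> bool"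
  where "realcompactification_le Z H e K k \<longleftrightarrow>
    (\<exists>\<phi>. continuous_map K H \<phi> \<and> (\<forall>z\<in>topspace Z. \<phi> (k z) = e z))"

definition realcompactification_equiv ::
    "'a topology \<Rightarrow> 'b topology \<Rightarrow> ('a \<Rightarrow> 'b) \<Rightarrow> 'c topology \<Rightarrow> ('a \<Rightarrow> 'c) \<Rightarrow> bool"
  where "realcompactification_equiv Z H e K k \<longleftrightarrow>
    realcompactification Z H e \<and> realcompactification Z K k \<and>
    (\<exists>\<phi>. homeomorphic_map H K \<phi> \<and> (\<forall>z\<in>topspace Z. \<phi> (e z) = k z))"


section \<open>The Samuel realcompactification\<close>

text \<open>
  A uniform space is represented by a subset \<open>Z\<close> of a type of class \<open>uniform_space\<close> with the
  induced uniformity; taking \<open>Z = UNIV\<close> gives the type itself, and \<open>Z = {}\<close> the empty space.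
\<close>
definition extends_uniform_functions ::
    "'a::uniform_space set \<Rightarrow> 'b topology \<Rightarrow> ('a \<Rightarrow> 'b) \<Rightarrow> bool"
  where "extends_uniform_functions Z H e \<longleftrightarrow>
    (\<forall>f :: 'a \<Rightarrow> real. uniformly_continuous_on Z f \<longrightarrow>
       (\<exists>g. continuous_map H euclideanreal g \<and> (\<forall>z\<in>Z. g (e z) = f z)))"

text \<open>
  The competitors \<open>K\<close> have points of type \<open>'a set set\<close>. Since a point of a Hausdorff space is
  determined by the traces of its neighbourhoods on a dense subset, every realcompactification has
  a copy on this type; minimality among realcompactifications on arbitrary types is
  \<open>samuel_realcompactification_le\<close>, and existence is \<open>samuel_realcompactification_exists\<close>.
\<close>
definition samuel_realcompactification ::
    "'a::uniform_space set \<Rightarrow> 'b topology \<Rightarrow> ('a \<Rightarrow> 'b) \<Rightarrow> bool"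
  where "samuel_realcompactification Z H e \<longleftrightarrow>
    realcompactification (top_of_set Z) H e \<and> extends_uniform_functions Z H e \<and>
    (\<forall>(K :: 'a set set topology) k.
       realcompactification (top_of_set Z) K k \<and> extends_uniform_functions Z K k \<longrightarrow>
       realcompactification_le (top_of_set Z) H e K k)"

definition samuel_realcompact :: "'a::uniform_space set \<Rightarrow> bool"
  where "samuel_realcompact Z \<longleftrightarrow> samuel_realcompactification Z (top_of_set Z) (\<lambda>z. z)"


section \<open>Independence of the types chosen in the definitions\<close>

lemma realcompact_spaceI:
  fixes T :: "'a topology" and I :: "'i set"
  assumes C: "closedin (powertop_real I) C"
    and T: "T homeomorphic_space subtopology (powertop_real I) C"
  shows "realcompact_space T"
proof -
  obtain h h' where hh: "homeomorphic_maps T (subtopology (powertop_real I) C) h h'"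
    using T by (auto simp: homeomorphic_space_def)
  have CI: "C \<subseteq> topspace (powertop_real I)"
    using C closedin_subset by blast
  have h: "continuous_map T (powertop_real I) h" "h ` topspace T \<subseteq> C"
    and h': "continuous_map (subtopology (powertop_real I) C) T h'"
    and h'h: "\<And>x. x \<in> topspace T \<Longrightarrow> h' (h x) = x"
    and hh': "\<And>y. y \<in> C \<Longrightarrow> h (h' y) = y"
    using hh CI by (auto simp: homeomorphic_maps_def continuous_map_in_subtopology)
  define c where "c i = (\<lambda>x. h x i)" for i
  define J where "J = c ` I"
  define r where "r q = (\<lambda>i\<in>I. q (c i))" for q :: "('a \<Rightarrow> real) \<Rightarrow> real"
  have r: "continuous_map (powertop_real J) (powertop_real I) r"
    unfolding r_def
    by (auto simp: continuous_map_componentwise J_def intro!: continuous_map_product_projection)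
  define D where "D = {q \<in> topspace (powertop_real J). r q \<in> C}"
  have D: "closedin (powertop_real J) D"
    unfolding D_def using closedin_continuous_map_preimage [OF r C] .
  define s where "s x = (\<lambda>j\<in>J. j x)" for x :: 'a
  have ci: "continuous_map T euclideanreal (c i)" if "i \<in> I" for i
    using h(1) that unfolding c_def continuous_map_componentwise by auto
  have rs: "r (s x) = h x" if "x \<in> topspace T" for x
  proof -
    have "h x \<in> extensional I"
      using h that CI by (force simp: PiE_def)
    then show ?thesis
      by (auto simp: r_def s_def J_def c_def fun_eq_iff extensional_def)
  qed
  have s: "continuous_map T (powertop_real J) s"
    unfolding s_def by (auto simp: continuous_map_componentwise J_def ci)
  have sD: "s ` topspace T \<subseteq> D"
    using s h(2) rs unfolding D_def continuous_map_def by (auto simp: image_subset_iff Pi_iff)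
  have h'r: "continuous_map (subtopology (powertop_real J) D) T (h' \<circ> r)"
  proof (rule continuous_map_compose [OF _ h'])
    show "continuous_map (subtopology (powertop_real J) D) (subtopology (powertop_real I) C) r"
      using r by (auto simp: continuous_map_in_subtopology D_def continuous_map_from_subtopology)
  qed
  have "s (h' (r q)) = q" if q: "q \<in> D" for q
  proof -
    have rC: "r q \<in> C" and qe: "q \<in> extensional J"
      using q by (auto simp: D_def PiE_def)
    have "c i (h' (r q)) = q (c i)" if "i \<in> I" for i
      using hh' [OF rC] that by (simp add: c_def r_def)
    then show ?thesis
      using qe by (auto simp: s_def J_def fun_eq_iff extensional_def)
  qed
  then have "homeomorphic_maps T (subtopology (powertop_real J) D) s (h' \<circ> r)"
    using s sD h'r rs h'h by (auto simp: homeomorphic_maps_def continuous_map_in_subtopology)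
  with D show ?thesis
    unfolding realcompact_space_def homeomorphic_space_def by blast
qed

lemma realcompact_space_homeomorphic:
  assumes "realcompact_space S" and "S homeomorphic_space T"
  shows "realcompact_space T"
proof -
  obtain I :: "('a \<Rightarrow> real) set" and C where C: "closedin (powertop_real I) C"
    and "S homeomorphic_space subtopology (powertop_real I) C"
    using assms(1) unfolding realcompact_space_def by (elim exE conjE)
  then have "T homeomorphic_space subtopology (powertop_real I) C"
    using assms(2) homeomorphic_space_sym homeomorphic_space_trans by metis
  with C show ?thesis by (rule realcompact_spaceI)
qed

lemma realcompact_imp_Hausdorff_space:
  assumes "realcompact_space T"
  shows "Hausdorff_space T"
proof -
  obtain I :: "('a \<Rightarrow> real) set" and C where "T homeomorphic_space subtopology (powertop_real I) C"
    using assms unfolding realcompact_space_def by (elim exE conjE)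
  moreover have "Hausdorff_space (subtopology (powertop_real I) C)"
    by (simp add: Hausdorff_space_subtopology Hausdorff_space_product_topology)
  ultimately show ?thesis
    using homeomorphic_Hausdorff_space by metis
qed

lemma samuel_realcompactification_le:
  fixes Z :: "'a::uniform_space set" and K :: "'k topology"
  assumes H: "samuel_realcompactification Z H e"
    and K: "realcompactification (top_of_set Z) K k" "extends_uniform_functions Z K k"
  shows "realcompactification_le (top_of_set Z) H e K k"
proof -
  have rK: "realcompact_space K" and emb: "embedding_map (top_of_set Z) K k"
    and dense: "K closure_of (k ` Z) = topspace K"
    using K(1) by (auto simp: realcompactification_def)
  have kZ: "k ` Z \<subseteq> topspace K"
    using emb by (metis embedding_map_def homeomorphic_imp_surjective_map inf.cobounded1
        topspace_euclidean_subtopology topspace_subtopology)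
  define t where "t p = {A. \<exists>U. openin K U \<and> p \<in> U \<and> {z\<in>Z. k z \<in> U} \<subseteq> A}" for p
  have "inj_on t (topspace K)"
  proof (rule inj_onI, rule ccontr)
    fix p q assume p: "p \<in> topspace K" and q: "q \<in> topspace K" and eq: "t p = t q" and "p \<noteq> q"
    have "\<exists>U V. openin K U \<and> openin K V \<and> p \<in> U \<and> q \<in> V \<and> disjnt U V"
      using realcompact_imp_Hausdorff_space [OF rK] p q \<open>p \<noteq> q\<close>
      by (simp add: Hausdorff_space_def)
    then obtain U V where UV: "openin K U" "openin K V" "p \<in> U" "q \<in> V" "disjnt U V"
      by (elim exE conjE)
    have "{z\<in>Z. k z \<in> U} \<in> t p"
      unfolding t_def mem_Collect_eq using UV(1,3) by (intro exI [of _ U] conjI) simp_all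
    then have "{z\<in>Z. k z \<in> U} \<in> t q"
      by (simp only: eq)
    then obtain W where W: "openin K W" "q \<in> W" "{z\<in>Z. k z \<in> W} \<subseteq> {z\<in>Z. k z \<in> U}"
      unfolding t_def mem_Collect_eq by (elim exE conjE)
    have "openin K (V \<inter> W)" "q \<in> V \<inter> W"
      using UV W by auto
    moreover have "q \<in> K closure_of (k ` Z)"
      using dense q by simp
    ultimately obtain z where "z \<in> Z" "k z \<in> V \<inter> W"
      unfolding in_closure_of by blast
    then show False
      using W(3) UV(5) by (auto simp: disjnt_def)
  qed
  define L where "L = pullback_topology (t ` topspace K) (inv_into (topspace K) t) K"
  have inv: "inv_into (topspace K) t (t p) = p" if "p \<in> topspace K" for p
    using \<open>inj_on t (topspace K)\<close> that by simp
  have topL: "topspace L = t ` topspace K"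
    unfolding L_def topspace_pullback_topology using inv by auto
  have "continuous_map K L t"
    unfolding L_def
    by (rule continuous_map_pullback')
       (auto simp: inv intro: continuous_map_eq [OF continuous_map_id])
  moreover have "continuous_map L K (inv_into (topspace K) t)"
    unfolding L_def using continuous_map_pullback [OF continuous_map_id] by simp
  ultimately have hom: "homeomorphic_maps K L t (inv_into (topspace K) t)"
    by (auto simp: homeomorphic_maps_def topL inv)
  then have homt: "homeomorphic_map K L t"
    using homeomorphic_maps_map by blast
  have "realcompact_space L"
    using realcompact_space_homeomorphic [OF rK] homt homeomorphic_map_imp_homeomorphic_space
    by blast
  moreover have "embedding_map (top_of_set Z) L (t \<circ> k)"
    using embedding_map_compose [OF emb] homt surjective_embedding_map by metis
  moreover have "L closure_of ((t \<circ> k) ` Z) = topspace L"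
    using homeomorphic_map_closure_of [OF homt kZ] dense
    by (simp add: image_comp topL)
  ultimately have 1: "realcompactification (top_of_set Z) L (t \<circ> k)"
    by (simp add: realcompactification_def)
  have 2: "extends_uniform_functions Z L (t \<circ> k)"
    unfolding extends_uniform_functions_def
  proof (intro allI impI)
    fix f :: "'a \<Rightarrow> real" assume "uniformly_continuous_on Z f"
    then obtain g where g: "continuous_map K euclideanreal g" "\<forall>z\<in>Z. g (k z) = f z"
      using K(2) unfolding extends_uniform_functions_def by blast
    then show "\<exists>g. continuous_map L euclideanreal g \<and> (\<forall>z\<in>Z. g ((t \<circ> k) z) = f z)"
      using hom kZ inv
      by (intro exI [of _ "g \<circ> inv_into (topspace K) t"])
         (auto simp: homeomorphic_maps_def image_subset_iff intro: continuous_map_compose)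
  qed
  obtain \<phi> where "continuous_map L H \<phi>" "\<forall>z\<in>Z. \<phi> ((t \<circ> k) z) = e z"
    using H 1 2 unfolding samuel_realcompactification_def realcompactification_le_def by force
  then show ?thesis
    unfolding realcompactification_le_def using hom
    by (intro exI [of _ "\<phi> \<circ> t"]) (auto simp: homeomorphic_maps_def intro: continuous_map_compose)
qed


section \<open>Existence of the Samuel realcompactification\<close>

lemma list_split_at_level:
  fixes xs :: "real list"
  assumes "0 \<le> t" "t < sum_list xs"
  shows "\<exists>a x b. xs = a @ x # b \<and> sum_list a \<le> t \<and> t < sum_list a + x"
  using assms
proof (induction xs arbitrary: t)
  case (Cons y ys)
  show ?case
  proof (cases "t < y")
    case True
    then show ?thesis using Cons.prems by (intro exI [of _ "[]"]) auto
  next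
    case False
    then obtain a x b where "ys = a @ x # b" "sum_list a \<le> t - y" "t - y < sum_list a + x"
      using Cons.IH [of "t - y"] Cons.prems by auto
    then show ?thesis by (intro exI [of _ "y # a"]) auto
  qed
qed auto

primrec uniform_chain :: "(nat \<Rightarrow> 'a \<times> 'a \<Rightarrow> bool) \<Rightarrow> 'a \<Rightarrow> nat list \<Rightarrow> 'a \<Rightarrow> bool"
  where
    "uniform_chain W x [] y \<longleftrightarrow> x = y"
  | "uniform_chain W x (n # ns) y \<longleftrightarrow> (\<exists>z. W n (x, z) \<and> uniform_chain W z ns y)"

lemma uniform_chain_append:
  "uniform_chain W x (ns @ ms) y \<longleftrightarrow> (\<exists>z. uniform_chain W x ns z \<and> uniform_chain W z ms y)"
  by (induction ns arbitrary: x) auto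

abbreviation chain_weight :: "nat list \<Rightarrow> real"
  where "chain_weight ns \<equiv> sum_list (map (\<lambda>n. (1/2) ^ n) ns)"

lemma chain_weight_nonneg: "0 \<le> chain_weight ns"
  by (induction ns) auto

lemma uniform_chain_short:
  assumes refl: "\<And>n x. W n (x, x)"
    and cube: "\<And>n x y z u. W (Suc n) (x, y) \<Longrightarrow> W (Suc n) (y, z) \<Longrightarrow> W (Suc n) (z, u) \<Longrightarrow> W n (x, u)"
    and "uniform_chain W x ns y" "chain_weight ns < (1/2) ^ Suc n"
  shows "W n (x, y)"
  using assms(3,4)
proof (induction "length ns" arbitrary: ns n x y rule: less_induct)
  case less
  have anti: "W n (x, y)" if "n \<le> m" "W m (x, y)" for n m x y
    using that by (induction rule: dec_induct) (auto intro: cube refl)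
  show ?case
  proof (cases "ns = []")
    case True
    then show ?thesis using less.prems refl by simp
  next
    case False
    have pos: "0 < chain_weight ns"
      using False chain_weight_nonneg by (cases ns) (auto intro: add_pos_nonneg)
    obtain as w bs where split: "map (\<lambda>n. (1/2) ^ n) ns = as @ w # bs"
      "sum_list as \<le> chain_weight ns / 2" "chain_weight ns / 2 < sum_list as + w"
      using list_split_at_level [of "chain_weight ns / 2" "map (\<lambda>n. (1/2) ^ n) ns"] pos by auto
    from split(1) obtain a m b where ns: "ns = a @ m # b"
      and as: "as = map (\<lambda>n. (1/2) ^ n) a" "w = (1/2) ^ m" "bs = map (\<lambda>n. (1/2) ^ n) b"
      by (auto simp: map_eq_append_conv)
    have sum: "chain_weight ns = chain_weight a + (1/2) ^ m + chain_weight b"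
      by (simp add: ns)
    have a: "chain_weight a < (1/2) ^ Suc (Suc n)" and b: "chain_weight b < (1/2) ^ Suc (Suc n)"
      using split(2,3) sum less.prems(2) by (auto simp: as)
    have "(1/2 :: real) ^ m < (1/2) ^ Suc n"
      using sum less.prems(2) chain_weight_nonneg [of a] chain_weight_nonneg [of b] by linarith
    then have m: "Suc n \<le> m"
      by (subst (asm) power_strict_decreasing_iff) auto
    obtain u v where uv: "uniform_chain W x a u" "W m (u, v)" "uniform_chain W v b y"
      using less.prems(1) by (auto simp: ns uniform_chain_append)
    have "W (Suc n) (x, u)" "W (Suc n) (v, y)"
      using less.hyps [OF _ uv(1) a] less.hyps [OF _ uv(3) b] by (auto simp: ns)
    then show ?thesis
      using cube anti [OF m uv(2)] by blast
  qed
qed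

lemma uniform_separation:
  fixes E :: "'a::uniform_space \<times> 'a \<Rightarrow> bool" and x :: 'a
  assumes E: "eventually E uniformity"
  obtains f :: "'a \<Rightarrow> real"
  where "uniformly_continuous_on UNIV f" "f x = 0" "\<And>y. \<not> E (x, y) \<Longrightarrow> 1 \<le> f y"
proof -
  let ?P = "\<lambda>V. eventually V uniformity \<and> (\<forall>x y. V (x, y) \<longrightarrow> V (y, x)) \<and> (\<forall>x y. V (x, y) \<longrightarrow> E (x, y))"
  let ?Q = "\<lambda>V W. \<forall>x y z u. W (x, y) \<longrightarrow> W (y, z) \<longrightarrow> W (z, u) \<longrightarrow> V (x, u)"
  have sym: "\<exists>W. eventually W uniformity \<and> (\<forall>x y. W (x, y) \<longrightarrow> W (y, x)) \<and> (\<forall>x y. W (x, y) \<longrightarrow> V (x, y))"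
    if "eventually V uniformity" for V :: "'a \<times> 'a \<Rightarrow> bool"
    using eventually_conj [OF that uniformity_sym [OF that]]
    by (intro exI [of _ "\<lambda>p. V p \<and> (case p of (x, y) \<Rightarrow> V (y, x))"]) auto
  have "\<exists>W. \<forall>n. ?P (W n) \<and> ?Q (W n) (W (Suc n))"
  proof (rule dependent_nat_choice)
    show "\<exists>V. ?P V" using sym [OF E] .
  next
    fix V and n :: nat assume V: "?P V"
    then obtain D where D: "eventually D uniformity" "\<And>x y z. D (x, y) \<Longrightarrow> D (y, z) \<Longrightarrow> V (x, z)"
      using uniformity_transE [of V] V by metis
    obtain D' where D': "eventually D' uniformity" "\<And>x y z. D' (x, y) \<Longrightarrow> D' (y, z) \<Longrightarrow> D (x, z)"
      using uniformity_transE [OF D(1)] by metis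
    obtain W where W: "eventually W uniformity" "\<And>x y. W (x, y) \<Longrightarrow> W (y, x)" "\<And>x y. W (x, y) \<Longrightarrow> D' (x, y)"
      using sym [OF D'(1)] by metis
    have DD: "D (x, y)" if "D' (x, y)" for x y
      using D'(2) [OF that] uniformity_refl [OF D'(1)] by blast
    have VD: "V (x, y)" if "D (x, y)" for x y
      using D(2) [OF that] uniformity_refl [OF D(1)] by blast
    have "V (a, d)" if "W (a, b)" "W (b, c)" "W (c, d)" for a b c d
      using D(2) [OF D'(2) [OF W(3) [OF that(1)] W(3) [OF that(2)]] DD [OF W(3) [OF that(3)]]] .
    moreover have "?P W"
      using W(1,2) VD [OF DD [OF W(3)]] V by simp
    ultimately show "\<exists>W. ?P W \<and> ?Q V W"
      by (intro exI [of _ W] conjI) metis+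
  qed
  then obtain W where W: "\<forall>n. ?P (W n) \<and> ?Q (W n) (W (Suc n))" ..
  have PW: "?P (W n)" and QW: "?Q (W n) (W (Suc n))" for n
    using spec [OF W, of n] by fast+
  define S where "S y = insert 1 {chain_weight ns | ns. uniform_chain W x ns y}" for y
  have Slb: "0 \<le> s" if "s \<in> S y" for s y
    using that chain_weight_nonneg by (auto simp: S_def)
  have bdd: "bdd_below (S y)" for y
    using Slb by (meson bdd_belowI)
  have ne: "S y \<noteq> {}" for y by (simp add: S_def)
  define f where "f y = 2 * Inf (S y)" for y
  have step: "f z \<le> f y + 2 * (1/2) ^ n" if "W n (y, z)" for n y z
  proof -
    have "Inf (S z) - (1/2) ^ n \<le> s" if sS: "s \<in> S y" for s
    proof (cases "s = 1")
      case True
      have "Inf (S z) \<le> 1"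
        using bdd by (intro cInf_lower) (auto simp: S_def)
      then show ?thesis using True by (smt (verit) zero_le_power half_gt_zero)
    next
      case False
      then obtain ns where ns: "s = chain_weight ns" "uniform_chain W x ns y"
        using sS by (auto simp: S_def)
      have "uniform_chain W x (ns @ [n]) z"
        using ns \<open>W n (y, z)\<close> by (auto simp: uniform_chain_append)
      then have "chain_weight (ns @ [n]) \<in> S z"
        unfolding S_def by blast
      then have "Inf (S z) \<le> chain_weight (ns @ [n])"
        using bdd by (intro cInf_lower)
      then show ?thesis by (simp add: ns)
    qed
    then have "Inf (S z) - (1/2) ^ n \<le> Inf (S y)"
      using ne by (intro cInf_greatest)
    then show ?thesis by (simp add: f_def)
  qed
  have "uniformly_continuous_on UNIV f"
    unfolding uniformly_continuous_on_uniformity filterlim_iff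
  proof (intro allI impI)
    fix P :: "real \<times> real \<Rightarrow> bool" assume "eventually P uniformity"
    then obtain r where r: "r > 0" "\<And>a b. dist a b < r \<Longrightarrow> P (a, b)"
      by (auto simp: eventually_uniformity_metric)
    obtain n where n: "(1/2 :: real) ^ n < r / 2"
      using real_arch_pow_inv [of "r/2" "1/2"] r(1) by auto
    have "P (f y, f z)" if "W n (y, z)" for y z
    proof (rule r(2))
      have "W n (z, y)" using that PW by blast
      then show "dist (f y) (f z) < r"
        using step [OF that] step [of n z y] n by (simp add: dist_real_def)
    qed
    moreover have "eventually (W n) (uniformity_on UNIV)" using PW by simp
    ultimately show "\<forall>\<^sub>F p in uniformity_on UNIV. P (case p of (y, z) \<Rightarrow> (f y, f z))"
      by (auto elim!: eventually_mono)
  qed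
  moreover have "f x = 0"
  proof -
    have "uniform_chain W x [] x" by simp
    then have "chain_weight [] \<in> S x" unfolding S_def by blast
    then have "Inf (S x) \<le> chain_weight []"
      using bdd by (intro cInf_lower)
    moreover have "0 \<le> Inf (S x)"
      using ne Slb by (intro cInf_greatest)
    ultimately show ?thesis by (simp add: f_def)
  qed
  moreover have "1 \<le> f y" if "\<not> E (x, y)" for y
  proof -
    have "1/2 \<le> s" if sS: "s \<in> S y" for s
    proof (rule ccontr)
      assume "\<not> 1/2 \<le> s"
      then obtain ns where ns: "uniform_chain W x ns y" "chain_weight ns < (1/2) ^ Suc 0"
        using sS by (auto simp: S_def)
      have "W 0 (x, y)"
        by (rule uniform_chain_short [OF _ _ ns]) (use PW QW uniformity_refl in blast)+
      then show False using PW \<open>\<not> E (x, y)\<close> by blast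
    qed
    then have "1/2 \<le> Inf (S y)"
      using ne by (intro cInf_greatest)
    then show ?thesis by (simp add: f_def)
  qed
  ultimately show thesis using that by blast
qed

lemma uniformly_continuous_on_subset':
  assumes "uniformly_continuous_on T f" "S \<subseteq> T"
  shows "uniformly_continuous_on S f"
proof -
  have "uniformity_on S \<le> uniformity_on T"
    using assms(2) by (intro inf_mono) auto
  then show ?thesis
    using assms(1) unfolding uniformly_continuous_on_uniformity by (meson filterlim_mono order_refl)
qed

theorem samuel_realcompactification_exists:
  fixes Z :: "'a::{uniform_space,t2_space} set"
  shows "\<exists>(H :: (('a \<Rightarrow> real) \<Rightarrow> real) topology) e. samuel_realcompactification Z H e"
proof -
  define F where "F = {f :: 'a \<Rightarrow> real. uniformly_continuous_on Z f}"
  define R where "R = powertop_real F"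
  define e where "e z = (\<lambda>f\<in>F. f z)" for z
  define H where "H = subtopology R (R closure_of (e ` Z))"
  have cont_e: "continuous_map (top_of_set Z) R e"
    unfolding R_def e_def
    by (auto simp: continuous_map_componentwise F_def intro: uniformly_continuous_imp_continuous)
  have eR: "e ` Z \<subseteq> topspace R"
    by (auto simp: R_def e_def)
  have eH: "e ` Z \<subseteq> R closure_of (e ` Z)"
    using eR by (rule closure_of_subset)
  have topH: "topspace H = R closure_of (e ` Z)"
    unfolding H_def by (simp add: closure_of_subset_topspace inf_absorb2)
  have sep: "\<exists>f\<in>F. f z = 0 \<and> (\<forall>y\<in>Z. y \<notin> V \<longrightarrow> 1 \<le> f y)"
    if z: "z \<in> V" and V: "open V" for z V
  proof -
    have "eventually (\<lambda>(x, y). x = z \<longrightarrow> y \<in> V) uniformity"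
      using z V open_uniformity by blast
    then obtain f :: "'a \<Rightarrow> real" where "uniformly_continuous_on UNIV f" "f z = 0" "\<And>y. y \<notin> V \<Longrightarrow> 1 \<le> f y"
      by (rule uniform_separation [where x = z]) auto
    then show ?thesis
      unfolding F_def by (auto intro: uniformly_continuous_on_subset')
  qed
  have "inj_on e Z"
  proof (rule inj_onI, rule ccontr)
    fix y z assume yz: "y \<in> Z" "z \<in> Z" "e y = e z" "y \<noteq> z"
    then obtain V where V: "open V" "z \<in> V" "y \<notin> V"
      using t1_space [of z y] by auto
    then obtain f where "f \<in> F" "f z = 0" "1 \<le> f y"
      using sep [of z V] yz by blast
    then show False
      using fun_cong [OF yz(3), of f] by (simp add: e_def)
  qed
  moreover have "open_map (top_of_set Z) (subtopology R (e ` Z)) e"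
    unfolding open_map_def
  proof (intro allI impI)
    fix V' assume "openin (top_of_set Z) V'"
    then obtain V where V: "open V" "V' = Z \<inter> V"
      by (auto simp: openin_open)
    show "openin (subtopology R (e ` Z)) (e ` V')"
    proof (subst openin_subopen, intro ballI)
      fix p assume "p \<in> e ` V'"
      then obtain z where z: "z \<in> Z" "z \<in> V" "p = e z" using V by auto
      then obtain f where f: "f \<in> F" "f z = 0" "\<forall>y\<in>Z. y \<notin> V \<longrightarrow> 1 \<le> f y"
        using sep V by blast
      have "openin R {q \<in> topspace R. q f \<in> {..<1}}"
        unfolding R_def using f(1)
        by (intro openin_continuous_map_preimage [OF continuous_map_product_projection]) auto
      then have "openin (subtopology R (e ` Z)) ({q \<in> topspace R. q f \<in> {..<1}} \<inter> e ` Z)"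
        by (auto simp: openin_subtopology)
      moreover have "{q \<in> topspace R. q f \<in> {..<1}} \<inter> e ` Z \<subseteq> e ` V'"
        using f V by (force simp: e_def)
      moreover have "p \<in> {q \<in> topspace R. q f \<in> {..<1}} \<inter> e ` Z"
        using z f eR by (auto simp: e_def)
      ultimately show "\<exists>T. openin (subtopology R (e ` Z)) T \<and> p \<in> T \<and> T \<subseteq> e ` V'"
        by blast
    qed
  qed
  moreover have "continuous_map (top_of_set Z) (subtopology R (e ` Z)) e"
    using cont_e by (auto simp: continuous_map_in_subtopology)
  ultimately have "homeomorphic_map (top_of_set Z) (subtopology R (e ` Z)) e"
    using eR by (intro bijective_open_imp_homeomorphic_map) auto
  then have emb: "embedding_map (top_of_set Z) H e"
    using eH by (simp add: embedding_map_def H_def subtopology_subtopology inf_absorb2)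
  have dense: "H closure_of (e ` Z) = topspace H"
    unfolding topH using eH by (simp add: H_def closure_of_subtopology inf_absorb2)
  have "realcompact_space H"
    by (rule realcompact_spaceI [of F "R closure_of (e ` Z)"])
       (auto simp: R_def H_def homeomorphic_space_refl)
  then have 1: "realcompactification (top_of_set Z) H e"
    using emb dense by (simp add: realcompactification_def)
  have 2: "extends_uniform_functions Z H e"
    unfolding extends_uniform_functions_def
  proof (intro allI impI)
    fix f :: "'a \<Rightarrow> real" assume "uniformly_continuous_on Z f"
    then have f: "f \<in> F" by (simp add: F_def)
    have "continuous_map H euclideanreal (\<lambda>q. q f)"
      unfolding H_def R_def using f
      by (intro continuous_map_from_subtopology continuous_map_product_projection)
    then show "\<exists>g. continuous_map H euclideanreal g \<and> (\<forall>z\<in>Z. g (e z) = f z)"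
      using f by (intro exI [of _ "\<lambda>q. q f"]) (auto simp: e_def)
  qed
  have 3: "realcompactification_le (top_of_set Z) H e K k"
    if K: "realcompactification (top_of_set Z) K k" "extends_uniform_functions Z K k"
    for K :: "'a set set topology" and k
  proof -
    have "\<forall>f\<in>F. \<exists>g. continuous_map K euclideanreal g \<and> (\<forall>z\<in>Z. g (k z) = f z)"
      using K(2) by (auto simp: extends_uniform_functions_def F_def)
    then obtain g where g: "\<And>f. f \<in> F \<Longrightarrow> continuous_map K euclideanreal (g f)"
      "\<And>f z. f \<in> F \<Longrightarrow> z \<in> Z \<Longrightarrow> g f (k z) = f z"
      by metis
    define \<phi> where "\<phi> p = (\<lambda>f\<in>F. g f p)" for p
    have \<phi>: "continuous_map K R \<phi>"
      unfolding R_def \<phi>_def by (auto simp: continuous_map_componentwise g)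
    have \<phi>k: "\<phi> (k z) = e z" if "z \<in> Z" for z
      using g(2) that by (auto simp: \<phi>_def e_def)
    have "\<phi> ` topspace K = \<phi> ` (K closure_of (k ` Z))"
      using K(1) by (simp add: realcompactification_def)
    also have "\<dots> \<subseteq> R closure_of (\<phi> ` k ` Z)"
      by (rule continuous_map_image_closure_subset [OF \<phi>])
    also have "\<phi> ` k ` Z = e ` Z"
      using \<phi>k by (auto simp: image_iff)
    finally have "continuous_map K H \<phi>"
      using \<phi> by (auto simp: H_def continuous_map_in_subtopology)
    then show ?thesis
      using \<phi>k by (auto simp: realcompactification_le_def)
  qed
  show ?thesis
    using 1 2 3 unfolding samuel_realcompactification_def by blast
qed

end

theory Submission
  imports Defs
begin

text \<open>
  For a uniformly continuous \<open>f\<close> on \<open>X \<times> Y\<close>, each section \<open>f (x, _)\<close> extends to a continuous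
  function on \<open>H(U(Y))\<close>. If \<open>x\<close> and \<open>x'\<close> are close, the sections at \<open>x\<close> and \<open>x'\<close> differ by
  at most \<open>\<epsilon>\<close> everywhere on \<open>Y\<close>, hence, \<open>Y\<close> being dense, everywhere on \<open>H(U(Y))\<close>. This makes
  the sectionwise extension jointly continuous on \<open>X \<times> H(U(Y))\<close>
  (\<open>extends_uniform_functions_Times\<close>). The product \<open>X \<times> H(U(Y))\<close> is a realcompactification of
  \<open>X \<times> Y\<close> (\<open>realcompactification_Times\<close>), so it dominates \<open>H(U(X \<times> Y))\<close> by minimality of the
  latter.

  Conversely, the Samuel realcompactification of \<open>Z\<close> is the closure of \<open>Z\<close> in the power of the
  real line indexed by the uniformly continuous functions. Consequently a map \<open>p\<close> into \<open>Z\<close> from a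
  dense subset of a space \<open>K\<close>, followed by the embedding of \<open>Z\<close>, extends to a continuous map from \<open>K\<close> to the Samuel
  realcompactification as soon as all the functions \<open>f \<circ> p\<close>, with \<open>f\<close> uniformly continuous,
  extend to \<open>K\<close> (\<open>samuel_realcompactification_extension\<close>). For \<open>K = H(U(X \<times> Y))\<close> and the two
  projections this gives a continuous map to \<open>H(U(X)) \<times> H(U(Y))\<close> over \<open>X \<times> Y\<close>.

  Finally, when \<open>X\<close> is Samuel realcompact, \<open>X\<close> and \<open>H(U(X))\<close> dominate each other, so the three
  realcompactifications of \<open>X \<times> Y\<close> all dominate one another, and mutual domination is equivalence
  (\<open>realcompactification_equivI\<close>).
\<close>

section \<open>The order on realcompactifications\<close>

lemma realcompactification_imp_Hausdorff_space:
  "realcompactification Z H e \<Longrightarrow> Hausdorff_space H"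
  by (simp add: realcompactification_def realcompact_imp_Hausdorff_space)

lemma realcompactification_imp_continuous_map:
  "realcompactification Z H e \<Longrightarrow> continuous_map Z H e"
  by (metis realcompactification_def embedding_map_def homeomorphic_imp_continuous_map
      continuous_map_in_subtopology)

lemma realcompactification_le_refl: "realcompactification_le Z H e H e"
  unfolding realcompactification_le_def by (intro exI [of _ "\<lambda>x. x"]) auto

lemma realcompactification_le_trans:
  assumes "realcompactification_le Z H e K k" "realcompactification_le Z K k L l"
  shows "realcompactification_le Z H e L l"
proof -
  obtain \<phi> \<psi> where "continuous_map K H \<phi>" "\<forall>z\<in>topspace Z. \<phi> (k z) = e z"
      "continuous_map L K \<psi>" "\<forall>z\<in>topspace Z. \<psi> (l z) = k z"
    using assms unfolding realcompactification_le_def by blast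
  then show ?thesis
    unfolding realcompactification_le_def
    by (intro exI [of _ "\<phi> \<circ> \<psi>"]) (auto intro: continuous_map_compose)
qed

text \<open>Both composites of the comparison maps fix a dense subset of a Hausdorff space.\<close>
lemma realcompactification_equivI:
  assumes H: "realcompactification Z H e" and K: "realcompactification Z K k"
    and HK: "realcompactification_le Z H e K k" and KH: "realcompactification_le Z K k H e"
  shows "realcompactification_equiv Z H e K k"
proof -
  obtain \<phi> where \<phi>: "continuous_map K H \<phi>" "\<And>z. z \<in> topspace Z \<Longrightarrow> \<phi> (k z) = e z"
    using HK unfolding realcompactification_le_def by blast
  obtain \<psi> where \<psi>: "continuous_map H K \<psi>" "\<And>z. z \<in> topspace Z \<Longrightarrow> \<psi> (e z) = k z"
    using KH unfolding realcompactification_le_def by blast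
  have fix_dense: "g p = p"
    if L: "realcompactification Z L l" and g: "continuous_map L L g"
      and gl: "\<And>z. z \<in> topspace Z \<Longrightarrow> g (l z) = l z" and p: "p \<in> topspace L"
    for L :: "'x topology" and l g p
  proof (rule forall_in_closure_of_eq [OF _ realcompactification_imp_Hausdorff_space [OF L] g])
    show "p \<in> L closure_of (l ` topspace Z)"
      using L p by (simp add: realcompactification_def)
    show "continuous_map L L (\<lambda>p. p)" by simp
  qed (use gl in auto)
  have "(\<phi> \<circ> \<psi>) p = p" if "p \<in> topspace H" for p
  proof (rule fix_dense [OF H _ _ that])
    show "continuous_map H H (\<phi> \<circ> \<psi>)"
      using \<psi>(1) \<phi>(1) by (rule continuous_map_compose)
  qed (simp add: \<phi>(2) \<psi>(2))
  moreover have "(\<psi> \<circ> \<phi>) p = p" if "p \<in> topspace K" for p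
  proof (rule fix_dense [OF K _ _ that])
    show "continuous_map K K (\<psi> \<circ> \<phi>)"
      using \<phi>(1) \<psi>(1) by (rule continuous_map_compose)
  qed (simp add: \<phi>(2) \<psi>(2))
  ultimately have "homeomorphic_maps H K \<psi> \<phi>"
    using \<phi>(1) \<psi>(1) by (auto simp: homeomorphic_maps_def)
  then have "homeomorphic_map H K \<psi>"
    using homeomorphic_maps_map by blast
  with H K \<psi>(2) show ?thesis
    unfolding realcompactification_equiv_def by blast
qed

section \<open>Products of realcompactifications\<close>

lemma realcompact_space_prod_topology:
  assumes "realcompact_space S" "realcompact_space T"
  shows "realcompact_space (prod_topology S T)"
proof -
  obtain I :: "('a \<Rightarrow> real) set" and C where C: "closedin (powertop_real I) C"
    and "S homeomorphic_space subtopology (powertop_real I) C"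
    using assms(1) unfolding realcompact_space_def by (elim exE conjE)
  then obtain h h' where h: "homeomorphic_maps S (subtopology (powertop_real I) C) h h'"
    by (auto simp: homeomorphic_space_def)
  obtain J :: "('b \<Rightarrow> real) set" and D where D: "closedin (powertop_real J) D"
    and "T homeomorphic_space subtopology (powertop_real J) D"
    using assms(2) unfolding realcompact_space_def by (elim exE conjE)
  then obtain k k' where k: "homeomorphic_maps T (subtopology (powertop_real J) D) k k'"
    by (auto simp: homeomorphic_space_def)
  let ?R = "powertop_real (I <+> J)"
  \<comment> \<open>\<open>m\<close> identifies the product of the two powers with the power over the disjoint union of indices.\<close>
  define r where "r q = (\<lambda>i\<in>I. q (Inl i))" for q :: "('a \<Rightarrow> real) + ('b \<Rightarrow> real) \<Rightarrow> real"
  define s where "s q = (\<lambda>j\<in>J. q (Inr j))" for q :: "('a \<Rightarrow> real) + ('b \<Rightarrow> real) \<Rightarrow> real"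
  define m where "m p = (\<lambda>c\<in>I <+> J. case c of Inl i \<Rightarrow> fst p i | Inr j \<Rightarrow> snd p j)"
    for p :: "(('a \<Rightarrow> real) \<Rightarrow> real) \<times> (('b \<Rightarrow> real) \<Rightarrow> real)"
  have r: "continuous_map ?R (powertop_real I) r"
    unfolding r_def
    by (auto simp: continuous_map_componentwise intro!: continuous_map_product_projection)
  have s: "continuous_map ?R (powertop_real J) s"
    unfolding s_def
    by (auto simp: continuous_map_componentwise intro!: continuous_map_product_projection)
  have m: "continuous_map (prod_topology (powertop_real I) (powertop_real J)) ?R m"
    unfolding m_def
    by (auto simp: continuous_map_componentwise
        intro!: continuous_map_compose [OF continuous_map_fst continuous_map_product_projection, unfolded o_def]
          continuous_map_compose [OF continuous_map_snd continuous_map_product_projection, unfolded o_def])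
  have "homeomorphic_maps (prod_topology (powertop_real I) (powertop_real J)) ?R m (\<lambda>q. (r q, s q))"
    unfolding homeomorphic_maps_def
  proof (intro conjI ballI)
    show "continuous_map ?R (prod_topology (powertop_real I) (powertop_real J)) (\<lambda>q. (r q, s q))"
      using r s by (rule continuous_map_pairedI)
  next
    fix p assume "p \<in> topspace (prod_topology (powertop_real I) (powertop_real J))"
    then show "(r (m p), s (m p)) = p"
      by (cases p) (auto simp: r_def s_def m_def fun_eq_iff PiE_def extensional_def)
  next
    fix q assume "q \<in> topspace ?R"
    then show "m (r q, s q) = q"
      by (auto simp: r_def s_def m_def fun_eq_iff PiE_def extensional_def split: sum.split)
  qed (rule m)
  then have hm: "homeomorphic_map (prod_topology (powertop_real I) (powertop_real J)) ?R m"
    using homeomorphic_maps_map by blast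
  have CD: "closedin (prod_topology (powertop_real I) (powertop_real J)) (C \<times> D)"
    using C D by (simp add: closedin_prod_Times_iff)
  have "closedin ?R (m ` (C \<times> D))"
    using homeomorphic_map_closedness_eq [OF hm] CD by blast
  moreover have "prod_topology S T homeomorphic_space subtopology ?R (m ` (C \<times> D))"
  proof -
    have "homeomorphic_map (subtopology (prod_topology (powertop_real I) (powertop_real J)) (C \<times> D))
        (subtopology ?R (m ` (C \<times> D))) m"
      using closedin_subset [OF CD] homeomorphic_imp_surjective_map [OF hm]
      by (intro homeomorphic_map_subtopologies [OF hm])
         (use homeomorphic_imp_injective_map [OF hm] in \<open>blast dest: inj_on_image_Int\<close>)
    moreover have "prod_topology S T homeomorphic_space
        subtopology (prod_topology (powertop_real I) (powertop_real J)) (C \<times> D)"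
      using homeomorphic_space_prod_topology h k
      unfolding subtopology_Times homeomorphic_space_def by blast
    ultimately show ?thesis
      using homeomorphic_map_imp_homeomorphic_space homeomorphic_space_trans by blast
  qed
  ultimately show ?thesis by (rule realcompact_spaceI)
qed

lemma embedding_map_map_prod:
  assumes "embedding_map S S' f" "embedding_map T T' g"
  shows "embedding_map (prod_topology S T) (prod_topology S' T') (map_prod f g)"
proof -
  obtain f' g' where "homeomorphic_maps S (subtopology S' (f ` topspace S)) f f'"
      "homeomorphic_maps T (subtopology T' (g ` topspace T)) g g'"
    using assms unfolding embedding_map_def homeomorphic_map_maps by blast
  then have "homeomorphic_maps (prod_topology S T)
      (subtopology (prod_topology S' T') (f ` topspace S \<times> g ` topspace T))
      (\<lambda>(x, y). (f x, g y)) (\<lambda>(x, y). (f' x, g' y))"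
    by (simp add: homeomorphic_maps_prod subtopology_Times)
  moreover have "map_prod f g ` (topspace S \<times> topspace T) = f ` topspace S \<times> g ` topspace T"
    by (rule map_prod_surj_on) auto
  ultimately show ?thesis
    unfolding embedding_map_def homeomorphic_map_maps topspace_prod_topology
    by (intro exI [of _ "\<lambda>(x, y). (f' x, g' y)"]) (simp add: map_prod_def)
qed

lemma realcompactification_Times:
  assumes "realcompactification S H e" "realcompactification T K k"
  shows "realcompactification (prod_topology S T) (prod_topology H K) (map_prod e k)"
  using assms
  by (simp add: realcompactification_def realcompact_space_prod_topology embedding_map_map_prod
      map_prod_surj_on closure_of_Times)

lemma realcompactification_le_Times:
  assumes "realcompactification_le S H e H' e'" "realcompactification_le T K k K' k'"
  shows "realcompactification_le (prod_topology S T)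
    (prod_topology H K) (map_prod e k) (prod_topology H' K') (map_prod e' k')"
proof -
  obtain \<phi> \<psi> where "continuous_map H' H \<phi>" "\<forall>z\<in>topspace S. \<phi> (e' z) = e z"
      "continuous_map K' K \<psi>" "\<forall>z\<in>topspace T. \<psi> (k' z) = k z"
    using assms unfolding realcompactification_le_def by blast
  then show ?thesis
    unfolding realcompactification_le_def
    by (intro exI [of _ "map_prod \<phi> \<psi>"]) (auto simp: map_prod_def continuous_map_prod_top)
qed

section \<open>Maps into the Samuel realcompactification\<close>

text \<open>
  The evaluation map of \<open>Z\<close> into the power of the real line indexed by the uniformly continuous
  functions on \<open>Z\<close>. Indices are total functions, so functions that differ only outside \<open>Z\<close> occur
  as separate indices; this repeats coordinates without changing the topology induced on \<open>Z\<close>.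
\<close>
definition uniform_evaluation :: "'a::uniform_space set \<Rightarrow> 'a \<Rightarrow> ('a \<Rightarrow> real) \<Rightarrow> real"
  where "uniform_evaluation Z z = (\<lambda>f\<in>{f. uniformly_continuous_on Z f}. f z)"

abbreviation uniform_power :: "'a::uniform_space set \<Rightarrow> (('a \<Rightarrow> real) \<Rightarrow> real) topology"
  where "uniform_power Z \<equiv> powertop_real {f. uniformly_continuous_on Z f}"

lemma uniform_separation_open:
  fixes Z :: "'a::uniform_space set"
  assumes "open V" "z \<in> V"
  obtains f :: "'a \<Rightarrow> real"
  where "uniformly_continuous_on Z f" "f z = 0" "\<And>y. y \<notin> V \<Longrightarrow> 1 \<le> f y"
proof -
  have "eventually (\<lambda>(x, y). x = z \<longrightarrow> y \<in> V) uniformity"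
    using assms open_uniformity by blast
  then obtain f :: "'a \<Rightarrow> real"
    where "uniformly_continuous_on UNIV f" "f z = 0" "\<And>y. y \<notin> V \<Longrightarrow> 1 \<le> f y"
    by (rule uniform_separation [where x = z]) auto
  then show thesis
    using that uniformly_continuous_on_subset' by blast
qed

lemma embedding_map_uniform_evaluation:
  fixes Z :: "'a::{uniform_space,t2_space} set"
  shows "embedding_map (top_of_set Z) (uniform_power Z) (uniform_evaluation Z)"
proof -
  let ?F = "{f :: 'a \<Rightarrow> real. uniformly_continuous_on Z f}"
  let ?e = "uniform_evaluation Z"
  have cont: "continuous_map (top_of_set Z) (uniform_power Z) ?e"
    unfolding uniform_evaluation_def
    by (auto simp: continuous_map_componentwise intro: uniformly_continuous_imp_continuous)
  have inj: "inj_on ?e Z"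
  proof (rule inj_onI, rule ccontr)
    fix y z assume "?e y = ?e z" "y \<noteq> z"
    then obtain V where "open V" "z \<in> V" "y \<notin> V"
      using t1_space [of z y] by auto
    then obtain f where f: "f \<in> ?F" "f z = 0" "1 \<le> f y"
      using uniform_separation_open [of V z Z] by blast
    then show False
      using fun_cong [OF \<open>?e y = ?e z\<close>, of f] by (simp add: uniform_evaluation_def)
  qed
  have "continuous_map (subtopology (uniform_power Z) (?e ` Z)) (top_of_set Z) (inv_into Z ?e)"
    unfolding continuous_map_eq_topcontinuous_at topcontinuous_at_def
  proof (intro ballI conjI allI impI)
    fix q V assume q: "q \<in> topspace (subtopology (uniform_power Z) (?e ` Z))"
      and V: "openin (top_of_set Z) V \<and> inv_into Z ?e q \<in> V"
    obtain z where z: "z \<in> Z" "q = ?e z" using q by auto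
    obtain V' where V': "open V'" "V = Z \<inter> V'" "z \<in> V'"
      using V z inj by (auto simp: openin_open)
    then obtain f where f: "f \<in> ?F" "f z = 0" "\<And>y. y \<notin> V' \<Longrightarrow> 1 \<le> f y"
      using uniform_separation_open [of V' z Z] by blast
    let ?U = "{q \<in> topspace (subtopology (uniform_power Z) (?e ` Z)). q f \<in> {..<1}}"
    have "openin (subtopology (uniform_power Z) (?e ` Z)) ?U"
      using f(1) by (intro openin_continuous_map_preimage [where Y = euclideanreal]
          continuous_map_from_subtopology continuous_map_product_projection) auto
    moreover have "q \<in> ?U"
      using q z f by (auto simp: uniform_evaluation_def)
    moreover have "inv_into Z ?e p \<in> V" if p: "p \<in> ?U" for p
    proof -
      obtain y where y: "y \<in> Z" "p = ?e y" using p by auto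
      have "f y < 1" using p y f(1) by (simp add: uniform_evaluation_def)
      then have "y \<in> V'" using f(3) by force
      then show ?thesis using V' y inj by simp
    qed
    ultimately show "\<exists>U. openin (subtopology (uniform_power Z) (?e ` Z)) U \<and> q \<in> U \<and>
        (\<forall>p\<in>U. inv_into Z ?e p \<in> V)"
      by (intro exI [of _ ?U]) blast
  qed (auto simp: inv_into_into)
  then have "homeomorphic_maps (top_of_set Z) (subtopology (uniform_power Z) (?e ` Z)) ?e (inv_into Z ?e)"
    using cont inj by (auto simp: homeomorphic_maps_def continuous_map_in_subtopology f_inv_into_f)
  then show ?thesis
    by (auto simp: embedding_map_def homeomorphic_map_maps)
qed

text \<open>
  The closure of \<open>Z\<close> under the evaluation map is a realcompactification to which all uniformly
  continuous functions extend, so by minimality of \<open>H\<close> it has a continuous map to \<open>H\<close> over \<open>Z\<close>;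
  and maps into this closure are given coordinatewise.
\<close>
lemma samuel_realcompactification_extension:
  fixes Z :: "'a::{uniform_space,t2_space} set" and K :: "'k topology"
  assumes H: "samuel_realcompactification Z H e"
    and dense: "K closure_of (k ` W) = topspace K"
    and p: "p ` W \<subseteq> Z"
    and ext: "\<And>f :: 'a \<Rightarrow> real. uniformly_continuous_on Z f \<Longrightarrow>
      \<exists>g. continuous_map K euclideanreal g \<and> (\<forall>w\<in>W. g (k w) = f (p w))"
  obtains \<phi> where "continuous_map K H \<phi>" "\<And>w. w \<in> W \<Longrightarrow> \<phi> (k w) = e (p w)"
proof -
  let ?F = "{f :: 'a \<Rightarrow> real. uniformly_continuous_on Z f}"
  let ?e = "uniform_evaluation Z"
  let ?M = "subtopology (uniform_power Z) (uniform_power Z closure_of (?e ` Z))"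
  have eM: "?e ` Z \<subseteq> uniform_power Z closure_of (?e ` Z)"
    by (rule closure_of_subset) (auto simp: uniform_evaluation_def split: if_splits)
  have "realcompact_space ?M"
    by (rule realcompact_spaceI [OF closedin_closure_of homeomorphic_space_refl])
  moreover have "embedding_map (top_of_set Z) ?M ?e"
    using embedding_map_uniform_evaluation eM by (simp add: embedding_map_in_subtopology)
  moreover have "?M closure_of (?e ` Z) = topspace ?M"
    by (simp only: topspace_subtopology_subset [OF closure_of_subset_topspace]
        closure_of_subtopology inf_absorb2 [OF eM] inf_idem)
  ultimately have "realcompactification (top_of_set Z) ?M ?e"
    by (simp add: realcompactification_def)
  moreover have "extends_uniform_functions Z ?M ?e"
    unfolding extends_uniform_functions_def
  proof (intro allI impI)
    fix f :: "'a \<Rightarrow> real" assume f: "uniformly_continuous_on Z f"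
    have "continuous_map ?M euclideanreal (\<lambda>q. q f)"
      using f by (intro continuous_map_from_subtopology continuous_map_product_projection) simp
    then show "\<exists>g. continuous_map ?M euclideanreal g \<and> (\<forall>z\<in>Z. g (?e z) = f z)"
      using f by (intro exI [of _ "\<lambda>q. q f"]) (simp add: uniform_evaluation_def)
  qed
  ultimately have "realcompactification_le (top_of_set Z) H e ?M ?e"
    by (rule samuel_realcompactification_le [OF H])
  then obtain \<psi> where \<psi>: "continuous_map ?M H \<psi>" "\<And>z. z \<in> Z \<Longrightarrow> \<psi> (?e z) = e z"
    by (auto simp: realcompactification_le_def)
  obtain g where g: "\<And>f. f \<in> ?F \<Longrightarrow> continuous_map K euclideanreal (g f)"
      "\<And>f w. f \<in> ?F \<Longrightarrow> w \<in> W \<Longrightarrow> g f (k w) = f (p w)"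
    using ext by (metis mem_Collect_eq)
  define \<theta> where "\<theta> q = (\<lambda>f\<in>?F. g f q)" for q
  have \<theta>: "continuous_map K (uniform_power Z) \<theta>"
    unfolding \<theta>_def using g(1) by (auto simp: continuous_map_componentwise)
  have \<theta>k: "\<theta> (k w) = ?e (p w)" if "w \<in> W" for w
    using g(2) that by (auto simp: \<theta>_def uniform_evaluation_def)
  have "\<theta> ` topspace K \<subseteq> uniform_power Z closure_of (\<theta> ` k ` W)"
    using continuous_map_image_closure_subset [OF \<theta>, of "k ` W"] dense by simp
  also have "\<dots> \<subseteq> uniform_power Z closure_of (?e ` Z)"
    using p \<theta>k by (intro closure_of_mono) auto
  finally have "continuous_map K ?M \<theta>"
    using \<theta> by (auto simp: continuous_map_in_subtopology)
  then have "continuous_map K H (\<psi> \<circ> \<theta>)"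
    using \<psi>(1) by (rule continuous_map_compose)
  moreover have "(\<psi> \<circ> \<theta>) (k w) = e (p w)" if "w \<in> W" for w
    using that p \<theta>k \<psi>(2) by auto
  ultimately show thesis by (rule that)
qed

section \<open>Uniformly continuous functions on a product\<close>

lemma uniformly_continuous_on_fst:
  fixes X :: "'a::uniform_space set" and Y :: "'b::uniform_space set"
  shows "uniformly_continuous_on (X \<times> Y) fst"
proof -
  have "filterlim (\<lambda>(u, v). (fst u, fst v)) uniformity (uniformity :: (('a \<times> 'b) \<times> ('a \<times> 'b)) filter)"
    unfolding uniformity_prod_def filterlim_filtermap by (simp add: case_prod_unfold filterlim_fst)
  then show ?thesis
    unfolding uniformly_continuous_on_uniformity by (rule filterlim_mono [OF _ order_refl inf_le1])
qed

lemma uniformly_continuous_on_snd: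
  fixes X :: "'a::uniform_space set" and Y :: "'b::uniform_space set"
  shows "uniformly_continuous_on (X \<times> Y) snd"
proof -
  have "filterlim (\<lambda>(u, v). (snd u, snd v)) uniformity (uniformity :: (('a \<times> 'b) \<times> ('a \<times> 'b)) filter)"
    unfolding uniformity_prod_def filterlim_filtermap by (simp add: case_prod_unfold filterlim_snd)
  then show ?thesis
    unfolding uniformly_continuous_on_uniformity by (rule filterlim_mono [OF _ order_refl inf_le1])
qed

text \<open>The first coordinate moves within an entourage \<open>E\<close> that does not depend on the second.\<close>
lemma uniformly_continuous_on_TimesD:
  fixes f :: "'a::uniform_space \<times> 'b::uniform_space \<Rightarrow> real"
  assumes f: "uniformly_continuous_on (X \<times> Y) f" and \<epsilon>: "0 < \<epsilon>"
  obtains E D where "eventually E uniformity" "eventually D uniformity"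
    "\<And>x x' y y'. \<lbrakk>E (x, x'); D (y, y'); x \<in> X; x' \<in> X; y \<in> Y; y' \<in> Y\<rbrakk>
      \<Longrightarrow> dist (f (x, y)) (f (x', y')) < \<epsilon>"
proof -
  have "eventually (\<lambda>(u, v). dist u v < \<epsilon>) (uniformity :: (real \<times> real) filter)"
    using \<epsilon> by (auto simp: eventually_uniformity_metric)
  from uniformly_continuous_onD [OF f this] obtain E D
    where "eventually E uniformity" "eventually D uniformity"
      "\<And>x x' y y'. E (x, x') \<Longrightarrow> D (y, y') \<Longrightarrow>
         (x, y) \<in> X \<times> Y \<longrightarrow> (x', y') \<in> X \<times> Y \<longrightarrow> dist (f (x, y)) (f (x', y')) < \<epsilon>"
    by (auto simp: uniformity_prod_def eventually_filtermap eventually_prod_filter case_prod_unfold)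
  then show thesis by (intro that [of E D]) auto
qed

lemma uniformly_continuous_on_section:
  fixes f :: "'a::uniform_space \<times> 'b::uniform_space \<Rightarrow> real"
  assumes f: "uniformly_continuous_on (X \<times> Y) f" and x: "x \<in> X"
  shows "uniformly_continuous_on Y (\<lambda>y. f (x, y))"
  unfolding uniformly_continuous_on_uniformity filterlim_iff
proof (intro allI impI)
  fix P :: "real \<times> real \<Rightarrow> bool" assume "eventually P uniformity"
  then obtain \<epsilon> where \<epsilon>: "\<epsilon> > 0" "\<And>a b. dist a b < \<epsilon> \<Longrightarrow> P (a, b)"
    by (auto simp: eventually_uniformity_metric)
  obtain E D where "eventually E uniformity" "eventually D uniformity"
    "\<And>x x' y y'. \<lbrakk>E (x, x'); D (y, y'); x \<in> X; x' \<in> X; y \<in> Y; y' \<in> Y\<rbrakk>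
      \<Longrightarrow> dist (f (x, y)) (f (x', y')) < \<epsilon>"
    using uniformly_continuous_on_TimesD [OF f \<epsilon>(1)] by blast
  then show "\<forall>\<^sub>F p in uniformity_on Y. P (case p of (y, z) \<Rightarrow> (f (x, y), f (x, z)))"
    using x \<epsilon>(2) uniformity_refl [of E]
    unfolding eventually_inf_principal by (auto elim!: eventually_mono)
qed

lemma extends_uniform_functions_Times:
  fixes X :: "'a::uniform_space set" and Y :: "'b::uniform_space set"
  assumes e: "e ` Y \<subseteq> topspace H" and dense: "H closure_of (e ` Y) = topspace H"
    and ext: "extends_uniform_functions Y H e"
  shows "extends_uniform_functions (X \<times> Y) (prod_topology (top_of_set X) H) (map_prod (\<lambda>x. x) e)"
  unfolding extends_uniform_functions_def
proof (intro allI impI)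
  fix f :: "'a \<times> 'b \<Rightarrow> real" assume f: "uniformly_continuous_on (X \<times> Y) f"
  have "\<forall>x\<in>X. \<exists>g. continuous_map H euclideanreal g \<and> (\<forall>y\<in>Y. g (e y) = f (x, y))"
    using ext uniformly_continuous_on_section [OF f] unfolding extends_uniform_functions_def by blast
  then obtain g where g: "\<And>x. x \<in> X \<Longrightarrow> continuous_map H euclideanreal (g x)"
      "\<And>x y. x \<in> X \<Longrightarrow> y \<in> Y \<Longrightarrow> g x (e y) = f (x, y)"
    by metis
  have "continuous_map (prod_topology (top_of_set X) H) Met_TC.mtopology (\<lambda>(x, p). g x p)"
    unfolding Met_TC.continuous_map_to_metric
  proof (intro ballI allI impI)
    fix u :: "'a \<times> 'c" and \<epsilon> :: real
    assume "u \<in> topspace (prod_topology (top_of_set X) H)" and \<epsilon>: "0 < \<epsilon>"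
    then obtain x p where u: "u = (x, p)" and x: "x \<in> X" and p: "p \<in> topspace H"
      by auto
    obtain E D where E: "eventually E uniformity" and D: "eventually D uniformity"
      and ED: "\<And>x x' y y'. \<lbrakk>E (x, x'); D (y, y'); x \<in> X; x' \<in> X; y \<in> Y; y' \<in> Y\<rbrakk>
        \<Longrightarrow> dist (f (x, y)) (f (x', y')) < \<epsilon> / 2"
      using uniformly_continuous_on_TimesD [OF f, of "\<epsilon> / 2"] \<epsilon> by auto
    have "eventually (\<lambda>x'. E (x, x')) (nhds x)"
      using E eventually_mono eventually_nhds_uniformity by fastforce
    then obtain A where A: "open A" "x \<in> A" "\<And>x'. x' \<in> A \<Longrightarrow> E (x, x')"
      by (auto simp: eventually_nhds)
    let ?B = "{p' \<in> topspace H. g x p' \<in> ball (g x p) (\<epsilon> / 2)}"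
    have B: "openin H ?B"
      using g(1) [OF x] by (rule openin_continuous_map_preimage) simp
    \<comment> \<open>The bound is a closed condition on the point of \<open>H\<close>, so it passes from the dense set \<open>Y\<close> to \<open>H\<close>.\<close>
    have near: "dist (g x p') (g x' p') \<le> \<epsilon> / 2"
      if x': "x' \<in> X \<inter> A" and p': "p' \<in> topspace H" for x' p'
    proof (rule forall_in_closure_of [where X = H and S = "e ` Y"])
      show "p' \<in> H closure_of (e ` Y)"
        using p' dense by simp
      show "dist (g x q) (g x' q) \<le> \<epsilon> / 2" if "q \<in> e ` Y" for q
        using that x x' g(2) ED [OF A(3) uniformity_refl [OF D]] by (force intro: less_imp_le)
      have "continuous_map H euclideanreal (\<lambda>q. \<bar>g x q - g x' q\<bar>)"
        using g(1) x x' by (intro continuous_map_real_abs continuous_map_diff) auto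
      then have "closedin H {q \<in> topspace H. \<bar>g x q - g x' q\<bar> \<in> {..\<epsilon> / 2}}"
        by (rule closedin_continuous_map_preimage) simp
      then show "closedin H {q \<in> topspace H. dist (g x q) (g x' q) \<le> \<epsilon> / 2}"
        by (simp add: dist_real_def)
    qed
    let ?U = "(X \<inter> A) \<times> ?B"
    have "openin (prod_topology (top_of_set X) H) ?U"
      using A(1) B by (auto simp: openin_prod_Times_iff openin_open_Int)
    moreover have "u \<in> ?U"
      using u x p A \<epsilon> by simp
    moreover have "(case v of (x, p) \<Rightarrow> g x p) \<in> Met_TC.mball (case u of (x, p) \<Rightarrow> g x p) \<epsilon>"
      if v: "v \<in> ?U" for v
    proof -
      obtain x' p' where v': "v = (x', p')" "x' \<in> X \<inter> A" "p' \<in> ?B" using v by auto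
      then have "dist (g x p) (g x p') < \<epsilon> / 2" "dist (g x p') (g x' p') \<le> \<epsilon> / 2"
        using near by auto
      then have "dist (g x p) (g x' p') < \<epsilon>"
        using dist_triangle [of "g x p" "g x' p'" "g x p'"] by simp
      then show ?thesis using u v' by simp
    qed
    ultimately show "\<exists>U. openin (prod_topology (top_of_set X) H) U \<and> u \<in> U \<and>
        (\<forall>v\<in>U. (case v of (x, p) \<Rightarrow> g x p) \<in> Met_TC.mball (case u of (x, p) \<Rightarrow> g x p) \<epsilon>)"
      by (intro exI [of _ ?U]) blast
  qed
  then have "continuous_map (prod_topology (top_of_set X) H) euclideanreal (\<lambda>(x, p). g x p)"
    by simp
  then show "\<exists>g. continuous_map (prod_topology (top_of_set X) H) euclideanreal g \<and>
      (\<forall>z\<in>X \<times> Y. g (map_prod (\<lambda>x. x) e z) = f z)"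
    using g(2) by (intro exI [of _ "\<lambda>(x, p). g x p"]) auto
qed

section \<open>The Samuel realcompactification of a product\<close>

text \<open>No completeness of the factors is needed for this half of the comparison.\<close>
lemma samuel_realcompactification_Times_ge:
  fixes X :: "'a::{uniform_space,t2_space} set" and Y :: "'b::{uniform_space,t2_space} set"
  assumes HX: "samuel_realcompactification X HX eX"
    and HY: "samuel_realcompactification Y HY eY"
    and K: "realcompactification (top_of_set (X \<times> Y)) K k"
    and ext: "extends_uniform_functions (X \<times> Y) K k"
  shows "realcompactification_le (top_of_set (X \<times> Y)) (prod_topology HX HY) (map_prod eX eY) K k"
proof -
  have dense: "K closure_of (k ` (X \<times> Y)) = topspace K"
    using K by (simp add: realcompactification_def)
  have extend: "\<exists>g. continuous_map K euclideanreal g \<and> (\<forall>w\<in>X \<times> Y. g (k w) = f (p w))"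
    if "uniformly_continuous_on (X \<times> Y) p" "p ` (X \<times> Y) \<subseteq> Z" "uniformly_continuous_on Z f"
    for p :: "'a \<times> 'b \<Rightarrow> 'z::uniform_space" and Z and f :: "'z \<Rightarrow> real"
    using ext uniformly_continuous_on_compose [OF that(1) uniformly_continuous_on_subset' [OF that(3,2)]]
    unfolding extends_uniform_functions_def by blast
  have 1: "fst ` (X \<times> Y) \<subseteq> X" and 2: "snd ` (X \<times> Y) \<subseteq> Y" by auto
  obtain \<phi> where \<phi>: "continuous_map K HX \<phi>" "\<And>w. w \<in> X \<times> Y \<Longrightarrow> \<phi> (k w) = eX (fst w)"
    using samuel_realcompactification_extension [OF HX dense 1
        extend [OF uniformly_continuous_on_fst 1]] by blast
  obtain \<psi> where \<psi>: "continuous_map K HY \<psi>" "\<And>w. w \<in> X \<times> Y \<Longrightarrow> \<psi> (k w) = eY (snd w)"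
    using samuel_realcompactification_extension [OF HY dense 2
        extend [OF uniformly_continuous_on_snd 2]] by blast
  show ?thesis
    unfolding realcompactification_le_def using \<phi> \<psi>
    by (intro exI [of _ "\<lambda>q. (\<phi> q, \<psi> q)"]) (auto simp: continuous_map_pairedI)
qed

theorem theorem3p2p5:
  fixes X :: "'a::{uniform_space,t2_space} set"
    and Y :: "'b::{uniform_space,t2_space} set"
    and HX :: "'c topology" and eX :: "'a \<Rightarrow> 'c"
    and HY :: "'d topology" and eY :: "'b \<Rightarrow> 'd"
    and HXY :: "'e topology" and eXY :: "'a \<times> 'b \<Rightarrow> 'e"
  assumes "samuel_realcompact X"
    and "samuel_realcompactification X HX eX"
    and "samuel_realcompactification Y HY eY"
    and "samuel_realcompactification (X \<times> Y) HXY eXY"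
  shows "realcompactification_equiv (top_of_set (X \<times> Y))
           HXY eXY
           (prod_topology HX HY) (map_prod eX eY)
       \<and> realcompactification_equiv (top_of_set (X \<times> Y))
           (prod_topology HX HY) (map_prod eX eY)
           (prod_topology (top_of_set X) HY) (map_prod (\<lambda>x. x) eY)"
proof -
  let ?Z = "top_of_set (X \<times> Y)"
  let ?P = "prod_topology (top_of_set X) HY" and ?p = "map_prod (\<lambda>x. x) eY"
  let ?Q = "prod_topology HX HY" and ?q = "map_prod eX eY"
  have samX: "samuel_realcompactification X (top_of_set X) (\<lambda>x. x)"
    using assms(1) by (simp add: samuel_realcompact_def)
  have rX: "realcompactification (top_of_set X) (top_of_set X) (\<lambda>x. x)"
      "extends_uniform_functions X (top_of_set X) (\<lambda>x. x)"
    and rHX: "realcompactification (top_of_set X) HX eX" "extends_uniform_functions X HX eX"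
    and rHY: "realcompactification (top_of_set Y) HY eY" "extends_uniform_functions Y HY eY"
    and rHXY: "realcompactification ?Z HXY eXY" "extends_uniform_functions (X \<times> Y) HXY eXY"
    using samX assms by (auto simp: samuel_realcompactification_def)
  have P: "realcompactification ?Z ?P ?p" and Q: "realcompactification ?Z ?Q ?q"
    using realcompactification_Times [OF rX(1) rHY(1)] realcompactification_Times [OF rHX(1) rHY(1)]
    by simp_all
  have "eY ` Y \<subseteq> topspace HY"
    using continuous_map_image_subset_topspace [OF realcompactification_imp_continuous_map [OF rHY(1)]]
    by simp
  moreover have "HY closure_of (eY ` Y) = topspace HY"
    using rHY(1) by (simp add: realcompactification_def)
  ultimately have "extends_uniform_functions (X \<times> Y) ?P ?p"
    using rHY(2) by (rule extends_uniform_functions_Times)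
  then have HXY_P: "realcompactification_le ?Z HXY eXY ?P ?p"
    by (rule samuel_realcompactification_le [OF assms(4) P])
  have Q_HXY: "realcompactification_le ?Z ?Q ?q HXY eXY"
    by (rule samuel_realcompactification_Times_ge [OF assms(2,3) rHXY])
  have "realcompactification_le (top_of_set X) (top_of_set X) (\<lambda>x. x) HX eX"
    by (rule samuel_realcompactification_le [OF samX rHX])
  then have P_Q: "realcompactification_le ?Z ?P ?p ?Q ?q"
    using realcompactification_le_Times [OF _ realcompactification_le_refl,
        of "top_of_set X" _ _ HX eX "top_of_set Y" HY eY] by simp
  show ?thesis
    using rHXY(1) P Q HXY_P Q_HXY P_Q
    by (blast intro: realcompactification_equivI realcompactification_le_trans)
qed

end
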